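(* Let $x_0\in(\pi,3\pi/2)$ be the first positive root of $\tan x=x$ and let $\gamma_0=-\dfrac{2\sin x_0}{x_0}$. For every fixed integer $t\geq 6$, \[ \liminf_{U\to\infty}\lambda_t(U)\geq c_t^{\mathrm F},\qquad c_t^{\mathrm F}=\frac{(t-1)\gamma_0-2}{2(t-2)}. \] Moreover, $c_t^{\mathrm F}>0$ for every integer $t\geq 6$.
   Context: For a finite set $A=\{a_1<\cdots<a_t\}\subset\mathbb Z$, write $\Delta^+(A)=\{a_j-a_i:1\leq i<j\leq t\}$. The set $A$ is a $t$-mark Golomb ruler if all these positive differences $a_j-a_i$ ($1\le i<j\le t$) are distinct, i.e. $|\Delta^+(A)|=\binom t2$. For an integer $U\geq 1$, $P_t(U)$ denotes the maximum of $\left|\bigcup_{i=1}^{b}\Delta^+(A_i)\right|$ over all finite families $A_1,\dots,A_b$ (including the empty family) of $t$-mark Golomb rulers for which the sets $\Delta^+(A_i)$ are pairwise disjoint and contained in $[1,U]$, where $[1,U]$ is the set of integers from $1$ to $U$. The uncovered proportion is $\lambda_t(U)=1-P_t(U)/U$. Numerically, $\gamma_0=0.434467256422\ldots$. *)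

theory Defs
  imports "HOL-Analysis.Analysis"
begin

definition pos_diffs :: "int set \<Rightarrow> int set" where
  "pos_diffs A = {b - a | a b. a \<in> A \<and> b \<in> A \<and> a < b}"

definition golomb_ruler :: "nat \<Rightarrow> int set \<Rightarrow> bool" where
  "golomb_ruler t A \<longleftrightarrow> finite A \<and> card A = t \<and>
     inj_on (\<lambda>(a, b). b - a) {(a, b). a \<in> A \<and> b \<in> A \<and> a < b}"

definition ruler_packing :: "nat \<Rightarrow> nat \<Rightarrow> nat \<Rightarrow> (nat \<Rightarrow> int set) \<Rightarrow> bool" where
  "ruler_packing t U b A \<longleftrightarrow>
     (\<forall>i\<in>{1..b}. golomb_ruler t (A i) \<and> pos_diffs (A i) \<subseteq> {1..int U}) \<and>
     disjoint_family_on (\<lambda>i. pos_diffs (A i)) {1..b}"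

definition max_covered :: "nat \<Rightarrow> nat \<Rightarrow> nat" where
  "max_covered t U =
     Max {card (\<Union>i\<in>{1..b}. pos_diffs (A i)) | b A. ruler_packing t U b A}"

definition uncovered :: "nat \<Rightarrow> nat \<Rightarrow> real" where
  "uncovered t U = 1 - real (max_covered t U) / real U"

definition x0 :: real where
  "x0 = (LEAST x. 0 < x \<and> tan x = x)"

definition gamma0 :: real where
  "gamma0 = - (2 * sin x0 / x0)"

definition cF :: "nat \<Rightarrow> real" where
  "cF t = ((real t - 1) * gamma0 - 2) / (2 * (real t - 2))"

lemma card_increasing_pairs:
  fixes A :: "int set"
  assumes "finite A"
  shows "card {(a, b). a \<in> A \<and> b \<in> A \<and> a < b} = card A choose 2"
proof -
  let ?P = "{(a, b). a \<in> A \<and> b \<in> A \<and> a < b}"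
  have "bij_betw (\<lambda>(a, b). {a, b}) ?P {S. S \<subseteq> A \<and> card S = 2}"
    unfolding bij_betw_def
  proof
    show "inj_on (\<lambda>(a, b). {a, b}) ?P"
      by (auto simp: inj_on_def doubleton_eq_iff)
    show "(\<lambda>(a, b). {a, b}) ` ?P = {S. S \<subseteq> A \<and> card S = 2}"
    proof (intro equalityI subsetI)
      fix S assume "S \<in> {S. S \<subseteq> A \<and> card S = 2}"
      then obtain x y where S: "S = {x, y}" "x \<noteq> y" "S \<subseteq> A"
        by (auto simp: card_2_iff)
      show "S \<in> (\<lambda>(a, b). {a, b}) ` ?P"
      proof (cases "x < y")
        case True then show ?thesis using S by (intro image_eqI[of _ _ "(x, y)"]) auto
      next
        case False then show ?thesis using S by (intro image_eqI[of _ _ "(y, x)"]) auto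
      qed
    qed auto
  qed
  then show ?thesis
    using n_subsets[OF assms, of 2] by (simp add: bij_betw_same_card)
qed

lemma golomb_ruler_iff_card:
  "golomb_ruler t A \<longleftrightarrow> finite A \<and> card A = t \<and> card (pos_diffs A) = t choose 2"
proof (cases "finite A")
  case True
  let ?P = "{(a, b). a \<in> A \<and> b \<in> A \<and> a < b}"
  have fin: "finite ?P"
    by (rule finite_subset[of _ "A \<times> A"]) (use True in auto)
  have "pos_diffs A = (\<lambda>(a, b). b - a) ` ?P"
    by (auto simp: pos_diffs_def image_def)
  then show ?thesis
    using inj_on_iff_eq_card[OF fin, of "\<lambda>(a, b). b - a"] card_increasing_pairs[OF True] True
    by (auto simp: golomb_ruler_def)
qed (simp add: golomb_ruler_def)

text \<open>The maximum in \<^const>\<open>max_covered\<close> ranges over a nonempty finite set.\<close>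

lemma max_covered_attained:
  shows "finite {card (\<Union>i\<in>{1..b}. pos_diffs (A i)) | b A. ruler_packing t U b A}"
    and "{card (\<Union>i\<in>{1..b}. pos_diffs (A i)) | b A. ruler_packing t U b A} \<noteq> {}"
proof -
  have "card (\<Union>i\<in>{1..b}. pos_diffs (A i)) \<le> U" if "ruler_packing t U b A" for b A
  proof -
    have "(\<Union>i\<in>{1..b}. pos_diffs (A i)) \<subseteq> {1..int U}"
      using that unfolding ruler_packing_def by blast
    then show ?thesis
      using card_mono[of "{1..int U}" "\<Union>i\<in>{1..b}. pos_diffs (A i)"] by simp
  qed
  then show "finite {card (\<Union>i\<in>{1..b}. pos_diffs (A i)) | b A. ruler_packing t U b A}"
    by (auto intro: rev_finite_subset[OF finite_atMost[of U]])
  have "ruler_packing t U 0 (\<lambda>_. {})"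
    by (simp add: ruler_packing_def disjoint_family_on_def)
  then show "{card (\<Union>i\<in>{1..b}. pos_diffs (A i)) | b A. ruler_packing t U b A} \<noteq> {}"
    by blast
qed

text \<open>The root named by \<^const>\<open>x0\<close> exists. Since \<^term>\<open>tan x\<close> is \<^term>\<open>0\<close> at the poles,
  these contribute no spurious solutions of \<^prop>\<open>tan x = (x::real)\<close>.\<close>

lemma x0_first_root:
  shows "pi < x0" and "x0 < 3 * pi / 2" and "tan x0 = x0"
    and "\<forall>y>0. tan y = y \<longrightarrow> x0 \<le> y"
proof -
  define g :: "real \<Rightarrow> real" where "g x = sin x - x * cos x" for x
  have g': "(g has_real_derivative x * sin x) (at x)" for x
    unfolding g_def by (auto intro!: derivative_eq_intros)
  have cont: "continuous_on S g" for S
    unfolding g_def by (intro continuous_intros)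
  have root: "g x = 0" if "0 < x" "tan x = x" for x
    using that by (cases "cos x = 0") (auto simp: g_def tan_def field_simps)
  have pos: "0 < g x" if "0 < x" "x \<le> pi" for x
  proof -
    have "g 0 < g x"
    proof (rule DERIV_pos_imp_increasing_open[where f = g and a = 0 and b = x])
      show "0 < x" by fact
      show "\<exists>d. DERIV g z :> d \<and> 0 < d" if "0 < z" "z < x" for z
      proof (intro exI conjI)
        have "0 < sin z" by (rule sin_gt_zero) (use that \<open>x \<le> pi\<close> in auto)
        then show "0 < z * sin z" using \<open>0 < z\<close> by simp
      qed (rule g')
    qed (rule cont)
    then show ?thesis by (simp add: g_def)
  qed
  have decr: "g y < g x" if "pi \<le> x" "x < y" "y \<le> 2 * pi" for x y
  proof (rule DERIV_neg_imp_decreasing_open[where f = g and a = x and b = y])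
    show "x < y" by fact
    show "\<exists>d. DERIV g z :> d \<and> d < 0" if "x < z" "z < y" for z
    proof (intro exI conjI)
      have "sin z < 0" by (rule sin_lt_zero) (use that \<open>pi \<le> x\<close> \<open>y \<le> 2 * pi\<close> in auto)
      moreover have "0 < z" using that \<open>pi \<le> x\<close> pi_gt_zero by linarith
      ultimately show "z * sin z < 0" by (simp add: mult_pos_neg)
    qed (rule g')
  qed (rule cont)
  have s3: "sin (3 * pi / 2) = -1" and c3: "cos (3 * pi / 2) = 0"
    using sin_3over2_pi cos_3over2_pi by (simp_all add: mult.commute)
  have "g (3 * pi / 2) = -1" "g pi = pi"
    by (simp_all add: g_def s3 c3 del: times_divide_eq_left times_divide_eq_right)
  then have "\<exists>x\<ge>pi. x \<le> 3 * pi / 2 \<and> g x = 0"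
    by (intro IVT2') (auto simp: cont)
  then obtain x where x: "pi \<le> x" "x \<le> 3 * pi / 2" "g x = 0" by blast
  have "x \<noteq> pi" "x \<noteq> 3 * pi / 2"
    by (metis x(3) \<open>g pi = pi\<close> pi_neq_zero, metis x(3) \<open>g (3 * pi / 2) = -1\<close> zero_neq_neg_one)
  with x have bnd: "pi < x" "x < 3 * pi / 2" by auto
  have "cos x \<noteq> 0"
  proof
    assume "cos x = 0"
    then have "sin x = 0" using x by (simp add: g_def)
    with \<open>cos x = 0\<close> show False using sin_cos_squared_add[of x] by simp
  qed
  then have tanx: "tan x = x" using x by (simp add: g_def tan_def field_simps)
  have least: "x \<le> y" if "0 < y" "tan y = y" for y
  proof (rule ccontr)
    assume "\<not> x \<le> y"
    then have "y < x" by simp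
    have "pi < y" using pos[of y] root[OF that] that by force
    then show False using decr[of y x] \<open>y < x\<close> bnd root[OF that] x pi_gt_zero by force
  qed
  have "x0 = x"
    unfolding x0_def by (rule Least_equality) (use bnd tanx least pi_gt_zero in auto)
  then show "pi < x0" "x0 < 3 * pi / 2" "tan x0 = x0"
    "\<forall>y>0. tan y = y \<longrightarrow> x0 \<le> y"
    using bnd tanx least by auto
qed

end

theory Submission
  imports Defs "HOL-Real_Asymp.Real_Asymp"
begin

text \<open>
  For a \<open>t\<close>-mark Golomb ruler \<open>A\<close>, expanding the square modulus of the exponential sum
  \<open>\<Sum>a\<in>A. exp (i a \<theta>)\<close> shows that the differences satisfy
  \<open>t + 2 * (\<Sum>d\<in>pos_diffs A. cos (d \<theta>)) \<ge> 0\<close>. So in a packing, the cosines over the covered set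
  cannot be very negative on average, whereas the full sum of \<open>cos (d \<theta>)\<close> over \<open>1, \<dots>, U\<close>
  at \<open>\<theta> = x0 / U\<close> is asymptotically \<open>U * sin x0 / x0 = - U * gamma0 / 2\<close>. The deficit must come
  from the uncovered elements, each contributing at least \<open>-1\<close>.
\<close>

lemma golomb_ruler_cos_sum_nonneg:
  fixes \<theta> :: real
  assumes "golomb_ruler t A"
  shows "0 \<le> real t + 2 * (\<Sum>d\<in>pos_diffs A. cos (of_int d * \<theta>))"
proof -
  have fin: "finite A" and card: "card A = t"
    and inj: "inj_on (\<lambda>(a, b). b - a) {(a, b). a \<in> A \<and> b \<in> A \<and> a < b}"
    using assms by (auto simp: golomb_ruler_def)
  define c where "c = (\<lambda>(a::int, b::int). cos (of_int (b - a) * \<theta>))"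
  let ?P = "{(a, b). a \<in> A \<and> b \<in> A \<and> a < b}"
  let ?Q = "{(a, b). a \<in> A \<and> b \<in> A \<and> b < a}"
  let ?D = "(\<lambda>a. (a, a)) ` A"
  have finP: "finite ?P" "finite ?Q"
    by (rule finite_subset[of _ "A \<times> A"]; use fin in auto)+
  \<comment> \<open>The square modulus is written as real part squared plus imaginary part squared;
    \<open>cos_diff\<close> merges the two double sums.\<close>
  have "0 \<le> (\<Sum>a\<in>A. cos (of_int a * \<theta>))\<^sup>2 + (\<Sum>a\<in>A. sin (of_int a * \<theta>))\<^sup>2"
    by simp
  also have "\<dots> = (\<Sum>a\<in>A. \<Sum>b\<in>A. c (a, b))"
    unfolding power2_eq_square sum_product sum.distrib[symmetric]
    by (intro sum.cong refl) (simp add: c_def left_diff_distrib cos_diff)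
  also have "\<dots> = sum c (A \<times> A)"
    by (simp add: sum.cartesian_product fin)
  \<comment> \<open>The diagonal yields the term \<open>t\<close>; the other two parts agree because
    cosine is even, whence the factor 2.\<close>
  also have "A \<times> A = ?P \<union> (?Q \<union> ?D)"
    by auto
  also have "sum c \<dots> = sum c ?P + sum c (?Q \<union> ?D)"
    by (rule sum.union_disjoint) (use finP fin in auto)
  also have "sum c (?Q \<union> ?D) = sum c ?Q + sum c ?D"
    by (rule sum.union_disjoint) (use finP fin in auto)
  also have "sum c ?D = real t"
    using card by (subst sum.reindex) (auto simp: inj_on_def c_def)
  also have "sum c ?Q = sum c ?P"
  proof (rule sum.reindex_bij_witness[where i = prod.swap and j = prod.swap])
    fix p assume "p \<in> ?Q"
    have "cos (of_int (x - y) * \<theta>) = cos (of_int (y - x) * \<theta>)" for x y :: int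
      using cos_minus[of "of_int (x - y) * \<theta>"] by (simp add: algebra_simps)
    then show "c (prod.swap p) = c p" by (cases p) (simp add: c_def)
  qed auto
  \<comment> \<open>Here the Golomb property enters: distinct pairs have distinct differences, so no
    cosine is lost in passing to the set.\<close>
  also have "sum c ?P = (\<Sum>d\<in>(\<lambda>(a, b). b - a) ` ?P. cos (of_int d * \<theta>))"
    by (subst sum.reindex[OF inj]) (auto simp: c_def intro!: sum.cong)
  also have "(\<lambda>(a, b). b - a) ` ?P = pos_diffs A"
    by (auto simp: pos_diffs_def image_def)
  finally show ?thesis by simp
qed

lemma finite_pos_diffs:
  assumes "finite A"
  shows "finite (pos_diffs A)"
proof (rule finite_subset)
  show "pos_diffs A \<subseteq> (\<lambda>(a, b). b - a) ` (A \<times> A)"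
    by (auto simp: pos_diffs_def)
qed (use assms in simp)

text \<open>A ruler has \<open>t * (t - 1) / 2\<close> differences, so the constant \<open>t\<close>
  can be traded for a multiple of their number. In this form the bound is additive over disjoint
  difference sets.\<close>

lemma golomb_ruler_cos_sum_ge_card:
  fixes \<theta> :: real
  assumes "golomb_ruler t A" "t \<ge> 1"
  shows "- real (card (pos_diffs A)) \<le> (real t - 1) * (\<Sum>d\<in>pos_diffs A. cos (of_int d * \<theta>))"
proof -
  let ?s = "\<Sum>d\<in>pos_diffs A. cos (of_int d * \<theta>)"
  have "card (pos_diffs A) = t choose 2"
    using assms(1) by (simp add: golomb_ruler_iff_card)
  \<comment> \<open>Parity of \<open>t * (t - 1)\<close> makes the natural-number division in
    \<open>choose_two\<close> exact.\<close>
  then have "2 * card (pos_diffs A) = t * (t - 1)"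
    using even_mult_iff[of t "t - 1"] by (cases t) (auto simp: choose_two)
  then have "real (2 * card (pos_diffs A)) = real (t * (t - 1))"
    by presburger
  then have "2 * real (card (pos_diffs A)) = real t * (real t - 1)"
    using \<open>t \<ge> 1\<close> by simp
  moreover have "0 \<le> (real t - 1) * (real t + 2 * ?s)"
    using golomb_ruler_cos_sum_nonneg[OF assms(1), of \<theta>] \<open>t \<ge> 1\<close> by simp
  ultimately show ?thesis by (simp add: algebra_simps)
qed

lemma ruler_packing_cos_sum_ge_card:
  fixes \<theta> :: real
  assumes "ruler_packing t U b A" "t \<ge> 1"
  defines "S \<equiv> \<Union>i\<in>{1..b}. pos_diffs (A i)"
  shows "- real (card S) \<le> (real t - 1) * (\<Sum>d\<in>S. cos (of_int d * \<theta>))"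
proof -
  have ruler: "golomb_ruler t (A i)" if "i \<in> {1..b}" for i
    using assms(1) that by (simp add: ruler_packing_def)
  then have fin: "\<forall>i\<in>{1..b}. finite (pos_diffs (A i))"
    by (auto simp: golomb_ruler_def intro: finite_pos_diffs)
  have disj: "\<forall>i\<in>{1..b}. \<forall>j\<in>{1..b}. i \<noteq> j \<longrightarrow> pos_diffs (A i) \<inter> pos_diffs (A j) = {}"
    using assms(1) by (auto simp: ruler_packing_def disjoint_family_on_def)
  have "- real (card S) = (\<Sum>i\<in>{1..b}. - real (card (pos_diffs (A i))))"
    unfolding S_def by (subst card_UN_disjoint[OF _ fin disj]) (simp_all add: sum_negf)
  also have "\<dots> \<le> (\<Sum>i\<in>{1..b}. (real t - 1) * (\<Sum>d\<in>pos_diffs (A i). cos (of_int d * \<theta>)))"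
    by (intro sum_mono golomb_ruler_cos_sum_ge_card ruler assms(2))
  also have "\<dots> = (real t - 1) * (\<Sum>d\<in>S. cos (of_int d * \<theta>))"
    unfolding S_def by (subst sum.UNION_disjoint[OF _ fin disj]) (simp_all add: sum_distrib_left)
  finally show ?thesis .
qed

text \<open>Covered elements contribute at least \<open>-1 / (t - 1)\<close> on average, uncovered
  ones at least \<open>-1\<close> each. A very negative total therefore forces many uncovered
  elements.\<close>

lemma uncovered_ge_cos_sum:
  fixes \<theta> :: real
  assumes "t \<ge> 1" "U \<ge> 1"
  shows "- (real t - 1) * ((\<Sum>d=1..U. cos (real d * \<theta>)) / real U) - 1 \<le> (real t - 2) * uncovered t U"
proof -
  obtain b A where pack: "ruler_packing t U b A"
    and max: "max_covered t U = card (\<Union>i\<in>{1..b}. pos_diffs (A i))"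
    using Max_in[OF max_covered_attained(1)[of t U] max_covered_attained(2)[of t U]]
    unfolding max_covered_def by auto
  define S where "S = (\<Union>i\<in>{1..b}. pos_diffs (A i))"
  have sub: "S \<subseteq> {1..int U}"
    using pack unfolding S_def ruler_packing_def by blast
  have "finite S" using sub finite_subset by blast
  have "card S \<le> U" using card_mono[OF _ sub] by simp
  have "card ({1..int U} - S) = U - card S"
    using card_Diff_subset[OF \<open>finite S\<close> sub] by simp
  then have cardR: "real (card ({1..int U} - S)) = real U - real (card S)"
    using \<open>card S \<le> U\<close> by simp
  define s where "s = (\<lambda>B. \<Sum>d\<in>B. cos (of_int d * \<theta>))"
  have "(\<Sum>d=1..U. cos (real d * \<theta>)) = s {1..int U}"
    unfolding s_def
    by (rule sum.reindex_bij_witness[where i = nat and j = int]) auto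
  also have "\<dots> = s ({1..int U} - S) + s S"
    unfolding s_def by (rule sum.subset_diff[OF sub]) simp
  finally have sum_split: "(\<Sum>d=1..U. cos (real d * \<theta>)) = s ({1..int U} - S) + s S" .
  have "(\<Sum>d\<in>{1..int U} - S. - 1) \<le> s ({1..int U} - S)"
    unfolding s_def by (intro sum_mono) simp
  then have "- (real U - real (card S)) \<le> s ({1..int U} - S)"
    using cardR by (simp add: sum_negf)
  then have R: "(real t - 1) * - (real U - real (card S)) \<le> (real t - 1) * s ({1..int U} - S)"
    using assms(1) by (intro mult_left_mono) auto
  have "- real (card S) \<le> (real t - 1) * s S"
    using ruler_packing_cos_sum_ge_card[OF pack assms(1)] by (simp add: S_def s_def)
  \<comment> \<open>Writing \<open>- card S\<close> as \<open>(U - card S) - U\<close> absorbs one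
    of the \<open>t - 1\<close> copies of \<open>U - card S\<close>, leaving the factor
    \<open>t - 2\<close>.\<close>
  with R have "- (real t - 1) * (\<Sum>d=1..U. cos (real d * \<theta>)) - real U
      \<le> (real t - 2) * (real U - real (card S))"
    unfolding sum_split by (simp add: algebra_simps)
  then have "(- (real t - 1) * (\<Sum>d=1..U. cos (real d * \<theta>)) - real U) / real U
      \<le> (real t - 2) * (real U - real (card S)) / real U"
    by (rule divide_right_mono) simp
  moreover have "uncovered t U = (real U - real (card S)) / real U"
    using assms(2) max by (simp add: uncovered_def S_def diff_divide_distrib)
  ultimately have "(- (real t - 1) * (\<Sum>d=1..U. cos (real d * \<theta>)) - real U) / real U
      \<le> (real t - 2) * uncovered t U"
    by (simp only: times_divide_eq_right)
  then show ?thesis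
    using assms(2) by (simp add: diff_divide_distrib)
qed

text \<open>The factor \<open>2 * sin (\<theta> / 2)\<close> makes the sum telescope. The product
  form stays valid where this factor vanishes.\<close>

lemma cos_sum_closed_form:
  fixes \<theta> :: real
  shows "2 * sin (\<theta> / 2) * (\<Sum>d=1..n. cos (real d * \<theta>)) = sin (real n * \<theta> + \<theta> / 2) - sin (\<theta> / 2)"
proof (induction n)
  case (Suc n)
  have "2 * sin (\<theta> / 2) * cos (real (Suc n) * \<theta>)
      = sin (real (Suc n) * \<theta> + \<theta> / 2) - sin (real (Suc n) * \<theta> - \<theta> / 2)"
    unfolding sin_add sin_diff by (simp add: algebra_simps)
  also have "real (Suc n) * \<theta> - \<theta> / 2 = real n * \<theta> + \<theta> / 2"
    by (simp add: field_simps)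
  finally show ?case using Suc by (simp add: distrib_left del: of_nat_Suc)
qed simp

text \<open>The average is a Riemann sum for the mean of cosine over \<open>[0, x]\<close>; the
  limit is read off from the closed form.\<close>

lemma cos_average_tendsto:
  fixes x :: real
  assumes "x > 0"
  shows "(\<lambda>U. (\<Sum>d=1..U. cos (real d * (x / real U))) / real U) \<longlonglongrightarrow> sin x / x"
proof (rule Lim_transform_eventually)
  \<comment> \<open>Half of the angle \<open>x / U\<close>, so that \<open>2 * U * h U = x\<close>;
    the denominator \<open>2 * U * sin (h U)\<close> thus becomes
    \<open>x * (sin (h U) / h U)\<close>, with limit \<open>x\<close>.\<close>
  define h where "h = (\<lambda>U::nat. x / (2 * real U))"
  have h0: "h \<longlonglongrightarrow> 0"
    unfolding h_def by real_asymp
  have hpos: "\<forall>\<^sub>F U in sequentially. h U \<noteq> 0"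
    using eventually_gt_at_top[of 0] by eventually_elim (use assms in \<open>simp add: h_def\<close>)
  have "((\<lambda>y::real. sin y / y) \<longlongrightarrow> 1) (at 0)"
    by real_asymp
  then have "(\<lambda>U. sin (h U) / h U) \<longlonglongrightarrow> 1"
    by (rule filterlim_compose) (use h0 hpos in \<open>simp add: filterlim_at\<close>)
  moreover have "(\<lambda>U. sin (x + h U) - sin (h U)) \<longlonglongrightarrow> sin (x + 0) - sin 0"
    by (intro tendsto_intros h0)
  ultimately have "(\<lambda>U. (sin (x + h U) - sin (h U)) / (x * (sin (h U) / h U)))
      \<longlonglongrightarrow> (sin (x + 0) - sin 0) / (x * 1)"
    using assms by (intro tendsto_divide tendsto_mult tendsto_const) auto
  then show "(\<lambda>U. (sin (x + h U) - sin (h U)) / (x * (sin (h U) / h U))) \<longlonglongrightarrow> sin x / x"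
    by simp
  \<comment> \<open>Ensures \<open>sin (h U) > 0\<close>, so that this factor can be
    cancelled.\<close>
  have "\<forall>\<^sub>F U in sequentially. h U < pi"
    using h0 pi_gt_zero by (rule order_tendstoD)
  then show "\<forall>\<^sub>F U in sequentially. (sin (x + h U) - sin (h U)) / (x * (sin (h U) / h U))
      = (\<Sum>d=1..U. cos (real d * (x / real U))) / real U"
    using eventually_gt_at_top[of 0]
  proof eventually_elim
    case (elim U)
    have "0 < h U" using elim assms by (simp add: h_def)
    then have "sin (h U) > 0" using elim by (intro sin_gt_zero) auto
    have "x / real U / 2 = h U" by (simp add: h_def)
    then have "2 * sin (h U) * (\<Sum>d=1..U. cos (real d * (x / real U))) = sin (x + h U) - sin (h U)"
      using cos_sum_closed_form[of "x / real U" U] elim by simp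
    moreover have "x * (sin (h U) / h U) = 2 * sin (h U) * real U"
      using elim assms by (simp add: h_def)
    ultimately show ?case
      using \<open>sin (h U) > 0\<close> by (metis less_numeral_extra(3) mult_divide_mult_cancel_left mult_eq_0_iff zero_neq_numeral)
  qed
qed

text \<open>The value 2/5 is the threshold for \<open>cF 6 > 0\<close>. Since
  \<open>gamma0 = - 2 * cos x0\<close> and \<open>(cos x0)\<^sup>2 = 1 / (1 + x0\<^sup>2)\<close>,
  it suffices that \<open>x0\<^sup>2 < 24\<close>.\<close>

lemma gamma0_gt: "gamma0 > 2 / 5"
proof -
  have x: "pi < x0" "x0 < 3 * pi / 2" "tan x0 = x0"
    using x0_first_root by auto
  have "x0 > 0" using x(1) pi_gt_zero by linarith
  have "cos (x0 - pi) > 0"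
    by (rule cos_gt_zero_pi) (use x in auto)
  then have neg: "cos x0 < 0" by (simp add: cos_diff)
  have sin: "sin x0 = x0 * cos x0"
    using x(3) neg by (simp add: tan_def field_simps)
  \<comment> \<open>Machin's formula gives \<open>pi < 16 / 5\<close>, hence
    \<open>3 * pi / 2 < 24 / 5\<close>, and \<open>(24 / 5)\<^sup>2 = 23.04\<close>.\<close>
  have "x0 < 24 / 5"
  proof -
    have "arctan (1 / 5) \<le> (1 / 5 :: real)" "0 < arctan (1 / 239 :: real)"
      by (rule arctan_le_self) simp_all
    then show ?thesis using machin x(2) by linarith
  qed
  then have "x0\<^sup>2 < (24 / 5)\<^sup>2"
    using \<open>x0 > 0\<close> by (intro power_strict_mono) auto
  then have lt: "1 + x0\<^sup>2 < 25" by (simp add: power2_eq_square)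
  have "1 = (1 + x0\<^sup>2) * (cos x0)\<^sup>2"
    using sin_cos_squared_add[of x0] unfolding sin by (simp add: algebra_simps power_mult_distrib)
  also have "\<dots> < 25 * (cos x0)\<^sup>2"
    using lt neg by (intro mult_strict_right_mono) auto
  finally have "1\<^sup>2 < (- 5 * cos x0)\<^sup>2"
    by (simp add: power_mult_distrib)
  then have "1 < - 5 * cos x0"
    by (rule power2_less_imp_less) (use neg in simp)
  moreover have "gamma0 = - 2 * cos x0"
    using \<open>x0 > 0\<close> by (simp add: gamma0_def sin)
  ultimately show ?thesis by simp
qed

theorem theorem3p1:
  fixes t :: nat
  assumes "t \<ge> 6"
  shows "liminf (\<lambda>U. ereal (uncovered t U)) \<ge> ereal (cF t) \<and> cF t > 0"
proof
  \<comment> \<open>The angle is optimal in the limit: \<open>sin x / x\<close> on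
    \<open>x > 0\<close> is stationary exactly where \<open>tan x = x\<close>, and its minimum is at
    the first such point.\<close>
  define D where "D = (\<lambda>U. (\<Sum>d=1..U. cos (real d * (x0 / real U))) / real U)"
  define f where "f = (\<lambda>U. (- (real t - 1) * D U - 1) / (real t - 2))"
  have "x0 > 0" using x0_first_root(1) pi_gt_zero by linarith
  then have "D \<longlonglongrightarrow> sin x0 / x0"
    unfolding D_def by (rule cos_average_tendsto)
  then have "f \<longlonglongrightarrow> (- (real t - 1) * (sin x0 / x0) - 1) / (real t - 2)"
    unfolding f_def using assms by (intro tendsto_intros) auto
  also have "(- (real t - 1) * (sin x0 / x0) - 1) / (real t - 2) = cF t"
  proof -
    have "(- (real t - 1) * (sin x0 / x0) - 1) / (real t - 2)
        = (2 * (- (real t - 1) * (sin x0 / x0) - 1)) / (2 * (real t - 2))"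
      by (rule mult_divide_mult_cancel_left[symmetric]) simp
    also have "2 * (- (real t - 1) * (sin x0 / x0) - 1) = (real t - 1) * gamma0 - 2"
      by (simp add: gamma0_def algebra_simps diff_divide_distrib)
    finally show ?thesis by (simp only: cF_def)
  qed
  finally have "liminf (\<lambda>U. ereal (f U)) = ereal (cF t)"
    by (intro lim_imp_Liminf) auto
  moreover have "\<forall>\<^sub>F U in sequentially. ereal (f U) \<le> ereal (uncovered t U)"
    using eventually_ge_at_top[of 1]
  proof eventually_elim
    case (elim U)
    then show ?case
      using uncovered_ge_cos_sum[of t U "x0 / real U"] assms
      by (simp add: f_def D_def divide_le_eq mult.commute)
  qed
  then have "liminf (\<lambda>U. ereal (f U)) \<le> liminf (\<lambda>U. ereal (uncovered t U))"
    by (rule Liminf_mono)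
  ultimately show "ereal (cF t) \<le> liminf (\<lambda>U. ereal (uncovered t U))" by simp
  \<comment> \<open>The assumption \<open>t \<ge> 6\<close> supplies \<open>t - 1 \<ge> 5\<close>,
    which exactly matches the bound 2/5 on \<open>gamma0\<close>.\<close>
  have "2 = 5 * (2 / 5 :: real)" by simp
  also have "\<dots> \<le> (real t - 1) * (2 / 5)" using assms by simp
  also have "\<dots> < (real t - 1) * gamma0"
    using assms gamma0_gt by (intro mult_strict_left_mono) auto
  finally show "cF t > 0"
    using assms by (simp add: cF_def)
qed

end
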